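(* Let $\{\mathsf{P}_\theta : \theta \in \mathbb{T}\}$ be a statistical model for data $X$ taking values in $\mathbb{X}$, and let $\tau_x : 2^{\mathbb{T}} \to [0,1]$, $x \in \mathbb{X}$, be a typicality measure, with $\tau_x(\theta) = \tau_x(\{\theta\})$, satisfying (i) $\tau_x(H) = \sup_{\theta \in H} \tau_x(\theta)$ for all $H \subseteq \mathbb{T}$ and all $x \in \mathbb{X}$; and (ii) $\sup_{\theta \in \mathbb{T}} \mathsf{P}_\theta\{\tau_X(\theta) \leq \alpha\} \leq \alpha$ for all $\alpha \in [0,1]$. Then the test procedure that rejects the hypothesis $H$ (i.e., "$\Theta \in H$") if and only if $\tau_x(H) \leq \alpha$ controls the frequentist Type I error in the sense that $$\sup_{\theta \in H} \mathsf{P}_\theta\{\tau_X(H) \leq \alpha\} \leq \alpha, \quad \text{for all } \alpha \in [0,1] \text{ and all } H \subseteq \mathbb{T}.$$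
   Context: The observable data $X$ takes values in a sample space $\mathbb{X}$. The statistical model $\{\mathsf{P}_\theta : \theta \in \mathbb{T}\}$ is a collection of probability distributions on $\mathbb{X}$ indexed by a parameter $\theta$ in a parameter space $\mathbb{T}$; $\Theta \in \mathbb{T}$ denotes the uncertain true value of the parameter. A hypothesis is a subset $H \subseteq \mathbb{T}$, identified with the assertion "$\Theta \in H$". The notation $\mathsf{P}_\theta\{\cdots X \cdots\}$ denotes the probability of the event in question when $X \sim \mathsf{P}_\theta$. A typicality measure assigns to each data value $x \in \mathbb{X}$ a set function $\tau_x : 2^{\mathbb{T}} \to [0,1]$, with $\tau_x(H)$ interpreted as the typicality of $x$ relative to the hypothesis $H$; data $x$ is called sufficiently atypical relative to $H$ at level $\alpha$ if $\tau_x(H) \leq \alpha$. One writes $\tau_x(\theta)$ for $\tau_x(\{\theta\})$. Suprema over the empty set of quantities in $[0,1]$ are taken to be $0$. *)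

theory Defs
  imports "HOL-Probability.Probability"
begin

(* Supremum of a set of quantities in [0,1], where the supremum of the empty set is 0;
   on type real, Sup {} is unspecified. *)
definition sup01 :: "real set \<Rightarrow> real" where
  "sup01 A = (if A = {} then 0 else Sup A)"

(* The data X is the identity on the sample space SX, so its law under the parameter t is P t. *)
definition statistical_model :: "'x measure \<Rightarrow> 't set \<Rightarrow> ('t \<Rightarrow> 'x measure) \<Rightarrow> bool" where
  "statistical_model SX T P \<longleftrightarrow> (\<forall>\<theta>\<in>T. prob_space (P \<theta>) \<and> sets (P \<theta>) = sets SX)"

definition typicality_measure :: "'x measure \<Rightarrow> 't set \<Rightarrow> ('x \<Rightarrow> 't set \<Rightarrow> real) \<Rightarrow> bool" where
  "typicality_measure SX T \<tau> \<longleftrightarrow> (\<forall>x\<in>space SX. \<forall>H. H \<subseteq> T \<longrightarrow> \<tau> x H \<in> {0..1})"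

(* Hypotheses H range over all subsets of the parameter space, so {x. \<tau> x H \<le> \<alpha>} need not be
   measurable, and "measure" would silently be 0 there. The probability of an event is therefore
   read as its outer probability, which is the ordinary one on measurable events
   (event_prob_eq_measure). *)
definition event_prob :: "'x measure \<Rightarrow> 'x set \<Rightarrow> real" where
  "event_prob M A = enn2real (outer_measure_of M A)"

lemma event_prob_eq_measure: "A \<in> sets M \<Longrightarrow> event_prob M A = measure M A"
  by (simp add: event_prob_def measure_def)

end

theory Submission
  imports Defs
begin

text \<open>
  If \<open>\<theta> \<in> H\<close> then maxitivity gives \<open>\<tau> x {\<theta>} \<le> \<tau> x H\<close> for every data value \<open>x\<close>: a test rejects
  \<open>H\<close> only if it rejects each simple hypothesis contained in \<open>H\<close>. The event of rejecting \<open>H\<close> is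
  therefore contained in the event of rejecting \<open>{\<theta>}\<close>, whose probability under \<open>P \<theta>\<close> is at most
  \<open>\<alpha>\<close> by validity. Since rejection events need not be measurable, the containment is turned into
  an inequality by monotonicity of the outer probability (\<open>event_prob_mono\<close>).

  The order-theoretic steps use that suprema of real sets behave as expected only for sets that
  are bounded above: typicalities lie in \<open>[0,1]\<close>, and outer probabilities of subsets of the sample
  space are at most \<open>1\<close>.
\<close>

lemma sup01_upper:
  assumes "bdd_above A" "a \<in> A"
  shows "a \<le> sup01 A"
  using assms by (auto simp: sup01_def intro: cSup_upper)

text \<open>The nonnegativity of the bound accounts for the value \<open>0\<close> at the empty set.\<close>

lemma sup01_least:
  assumes "0 \<le> c" "\<And>a. a \<in> A \<Longrightarrow> a \<le> c"
  shows "sup01 A \<le> c"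
  using assms by (auto simp: sup01_def intro: cSup_least)

lemma outer_measure_of_le_emeasure_space:
  assumes "A \<subseteq> space M"
  shows "outer_measure_of M A \<le> emeasure M (space M)"
  using assms by (auto simp: outer_measure_of_def intro: INF_lower)

text \<open>
  Finiteness of the measure matters: \<open>enn2real\<close> sends \<open>\<infinity>\<close> to \<open>0\<close>, so it is monotone only below
  \<open>\<infinity>\<close>, and the larger set has finite outer measure because it lies in the space.
\<close>

lemma (in finite_measure) event_prob_mono:
  assumes "A \<subseteq> B" "B \<subseteq> space M"
  shows "event_prob M A \<le> event_prob M B"
proof -
  have "outer_measure_of M B < \<top>"
    using outer_measure_of_le_emeasure_space[OF assms(2)]
    by (rule le_less_trans) (simp add: less_top[symmetric])
  with outer_measure_of_mono[OF assms(1), of M] show ?thesis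
    unfolding event_prob_def by (rule enn2real_mono)
qed

lemma (in prob_space) event_prob_le_1:
  assumes "A \<subseteq> space M"
  shows "event_prob M A \<le> 1"
  using event_prob_mono[OF assms order_refl]
  by (simp add: event_prob_eq_measure prob_space)

theorem proposition1:
  fixes SX :: "'x measure" and T :: "'t set"
    and P :: "'t \<Rightarrow> 'x measure" and \<tau> :: "'x \<Rightarrow> 't set \<Rightarrow> real"
  assumes model: "statistical_model SX T P"
    and typicality: "typicality_measure SX T \<tau>"
    and maxitive: "\<forall>x\<in>space SX. \<forall>H. H \<subseteq> T \<longrightarrow> \<tau> x H = sup01 ((\<lambda>\<theta>. \<tau> x {\<theta>}) ` H)"
    and valid: "\<forall>\<alpha>\<in>{0..1}.
      sup01 ((\<lambda>\<theta>. event_prob (P \<theta>) {x \<in> space SX. \<tau> x {\<theta>} \<le> \<alpha>}) ` T) \<le> \<alpha>"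
  shows "\<forall>\<alpha>\<in>{0..1}. \<forall>H. H \<subseteq> T \<longrightarrow>
      sup01 ((\<lambda>\<theta>. event_prob (P \<theta>) {x \<in> space SX. \<tau> x H \<le> \<alpha>}) ` H) \<le> \<alpha>"
proof (intro ballI allI impI)
  fix \<alpha> :: real and H :: "'t set"
  assume \<alpha>: "\<alpha> \<in> {0..1}" and H: "H \<subseteq> T"
  let ?reject = "\<lambda>H'. {x \<in> space SX. \<tau> x H' \<le> \<alpha>}"
  have prob: "prob_space (P \<theta>)" and space: "space (P \<theta>) = space SX" if "\<theta> \<in> T" for \<theta>
    using model that by (auto simp: statistical_model_def dest: sets_eq_imp_space_eq)
  have simple_le: "\<tau> x {\<theta>} \<le> \<tau> x H" if x: "x \<in> space SX" and \<theta>: "\<theta> \<in> H" for x \<theta>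
  proof -
    have "\<tau> x {\<theta>'} \<le> 1" if "\<theta>' \<in> H" for \<theta>'
      using typicality x H that by (auto simp: typicality_measure_def)
    then have "bdd_above ((\<lambda>\<theta>. \<tau> x {\<theta>}) ` H)"
      by (rule bdd_aboveI2)
    then show ?thesis
      using maxitive x H \<theta> by (auto intro: sup01_upper)
  qed
  have bdd: "bdd_above ((\<lambda>\<theta>. event_prob (P \<theta>) (?reject {\<theta>})) ` T)"
    by (rule bdd_aboveI2[where M = 1], rule prob_space.event_prob_le_1)
       (auto simp: prob space)
  have "event_prob (P \<theta>) (?reject H) \<le> \<alpha>" if \<theta>: "\<theta> \<in> H" for \<theta>
  proof -
    have T: "\<theta> \<in> T"
      using H \<theta> by auto
    interpret prob_space "P \<theta>"
      by (rule prob[OF T])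
    have "?reject H \<subseteq> ?reject {\<theta>}"
      using simple_le[OF _ \<theta>] by (auto intro: order_trans)
    then have "event_prob (P \<theta>) (?reject H) \<le> event_prob (P \<theta>) (?reject {\<theta>})"
      by (rule event_prob_mono) (auto simp: space[OF T])
    also have "\<dots> \<le> sup01 ((\<lambda>\<theta>. event_prob (P \<theta>) (?reject {\<theta>})) ` T)"
      by (rule sup01_upper[OF bdd]) (use T in auto)
    also have "\<dots> \<le> \<alpha>"
      using valid \<alpha> by blast
    finally show ?thesis .
  qed
  then show "sup01 ((\<lambda>\<theta>. event_prob (P \<theta>) (?reject H)) ` H) \<le> \<alpha>"
    using \<alpha> by (auto intro: sup01_least)
qed

end
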